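(* Let $\mathcal S(\varphi,\psi)=(\varphi+F(\varphi,\psi),A_0\psi)$ satisfy Hypotheses 1, 2, 3 stated in the context. Then there exists a unique function $W:\mathbb T^2\to\mathbb R$ such that the graph $\mathcal W=\{(W(\psi),\psi):\psi\in\mathbb T^2\}$ is contained in $\Lambda$ and is an invariant manifold for $\mathcal S$, i.e. $$\mathcal S(W(\psi),\psi)=(W(A_0\psi),A_0\psi)\qquad\text{for all }\psi\in\mathbb T^2 .$$ Moreover $W\in\mathfrak B^*_{\alpha_-,\alpha_+}(\mathbb T^2,\mathbb R)$ for suitable $\alpha_-,\alpha_+\in(0,\alpha_0]$.
   Context: $\mathbb T=\mathbb R/2\pi\mathbb Z$. $A_0$ is an Anosov (hyperbolic linear) automorphism of $\mathbb T^2$, with eigenvalues $\lambda_\pm$, $|\lambda_+|>1>|\lambda_-|$, $|\lambda_+\lambda_-|=1$, and corresponding unit eigenvectors $v_\pm$. For $g:\mathbb T^2\to\mathbb R$ and $\alpha\in(0,1]$ set $|g|_\alpha^\pm=\sup_{\psi\in\mathbb T^2}\sup_{x\in\mathbb R\setminus\{0\}}|g(\psi+xv_\pm)-g(\psi)|/|x|^\alpha$. $\mathfrak B^*_{\alpha_-,\alpha_+}(\mathbb T^2,\mathbb R)$ is the Banach space of bounded continuous $g$ with $\|g\|_{\alpha_-,\alpha_+}=\|g\|_\infty+\alpha_-|g|^-_{\alpha_-}+\alpha_+|g|^+_{\alpha_+}<\infty$. $F:\mathbb T\times\mathbb T^2\to\mathbb R$ belongs to $\mathscr B_{\alpha_0,6}(\mathbb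 T\times\mathbb T^2,\mathbb R)$ for some $\alpha_0\in(0,1]$: $F$ is 6 times continuously differentiable in $\varphi$ with bounded derivatives, and $\partial_\varphi^nF$, $0\le n\le5$, are $\alpha_0$-Hölder continuous in $\psi$ uniformly in $\varphi$. Hypothesis 1: there is a non-empty closed interval $\mathcal U=[\phi_m,\phi_M]\subsetneq\mathbb T$, $\phi_m<\phi_M$ (identified with an interval of $\mathbb R$), such that, with $\Omega=\mathcal U\times\mathbb T^2$, one has $1+\partial_\varphi F(\varphi,\psi)>0$ for all $(\varphi,\psi)\in\Omega$, and $F(\phi_m,\psi)>0$, $F(\phi_M,\psi)<0$ for all $\psi\in\mathbb T^2$. Hypothesis 2: for every $\psi\in\mathbb T^2$ there is a unique point $S(\psi)\in\operatorname{int}\mathcal U$ such that $F(S(\psi),\psi)=0$. Set $S_m=\inf_\psi S(\psi)$, $S_M=\sup_\psi S(\psi)$, $\Lambda=[S_m,S_M]\times\mathbb T^2$, $\Gamma=-\sup_{(\varphi,\psi)\in\Lambda}\partial_\varphi F(\varphi,\psi)$. Hypothesis 3: $\Gamma>0$. Under these hypotheses $\mathcal S$ maps $\Omega$ into itself and is regarded as a map on $\Omega\subset\mathbb R\times\mathbb T^2$. *)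

theory Defs
  imports "HOL-Analysis.Analysis"
begin

text \<open>
  Functions on the torus \<open>(\<real>/2\<pi>\<int>)\<^sup>2\<close> are represented by their lifts to the plane, i.e. by
  functions on \<open>real^2\<close> that are invariant under translations in \<open>2\<pi>\<int>\<^sup>2\<close>. Likewise a function on
  \<open>\<real>/2\<pi>\<int> \<times> (\<real>/2\<pi>\<int>)\<^sup>2\<close> is a function of \<open>\<phi> :: real\<close> and \<open>\<psi> :: real^2\<close> that is periodic in
  both arguments. Suprema, infima and quantifiers over the torus then range over the whole plane.
\<close>

definition on_torus :: "(real^2 \<Rightarrow> 'b) \<Rightarrow> bool" where
  "on_torus g \<longleftrightarrow>
     (\<forall>\<psi>. \<forall>k :: int^2. g (\<psi> + (\<chi> i. 2 * pi * of_int (k $ i))) = g \<psi>)"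

definition on_circle_torus :: "(real \<Rightarrow> real^2 \<Rightarrow> 'b) \<Rightarrow> bool" where
  "on_circle_torus F \<longleftrightarrow>
     (\<forall>\<phi>. on_torus (F \<phi>)) \<and> (\<forall>\<phi> \<psi>. F (\<phi> + 2 * pi) \<psi> = F \<phi> \<psi>)"

text \<open>
  The linear automorphisms of the torus are induced by the integer matrices of determinant \<open>\<plusminus>1\<close>.
  In the hyperbolic case the two eigenvalues are real, since complex conjugate ones would have
  equal moduli.
\<close>

definition anosov_automorphism ::
  "real^2^2 \<Rightarrow> real \<Rightarrow> real \<Rightarrow> real^2 \<Rightarrow> real^2 \<Rightarrow> bool" where
  "anosov_automorphism A lm lp vm vp \<longleftrightarrow>
     (\<forall>i j. A $ i $ j \<in> \<int>) \<and> \<bar>det A\<bar> = 1 \<and>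
     A *v vm = lm *\<^sub>R vm \<and> A *v vp = lp *\<^sub>R vp \<and> norm vm = 1 \<and> norm vp = 1 \<and>
     \<bar>lp\<bar> > 1 \<and> \<bar>lm\<bar> < 1 \<and> \<bar>lp * lm\<bar> = 1"

text \<open>Values in \<open>ennreal\<close>, so that a supremum that is not finite is \<open>\<infinity>\<close>.\<close>

definition directional_seminorm :: "real^2 \<Rightarrow> real \<Rightarrow> (real^2 \<Rightarrow> real) \<Rightarrow> ennreal" where
  "directional_seminorm v \<alpha> g =
     (SUP \<psi>. SUP x\<in>UNIV - {0}. ennreal (\<bar>g (\<psi> + x *\<^sub>R v) - g \<psi>\<bar> / \<bar>x\<bar> powr \<alpha>))"

definition Bstar_norm ::
  "real^2 \<Rightarrow> real^2 \<Rightarrow> real \<Rightarrow> real \<Rightarrow> (real^2 \<Rightarrow> real) \<Rightarrow> ennreal" where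
  "Bstar_norm vm vp am ap g =
     (SUP \<psi>. ennreal \<bar>g \<psi>\<bar>) + ennreal am * directional_seminorm vm am g
       + ennreal ap * directional_seminorm vp ap g"

definition Bstar :: "real^2 \<Rightarrow> real^2 \<Rightarrow> real \<Rightarrow> real \<Rightarrow> (real^2 \<Rightarrow> real) set" where
  "Bstar vm vp am ap =
     {g. on_torus g \<and> continuous_on UNIV g \<and> bounded (range g) \<and> Bstar_norm vm vp am ap g < \<infinity>}"

definition dphi :: "nat \<Rightarrow> (real \<Rightarrow> real^2 \<Rightarrow> real) \<Rightarrow> real \<Rightarrow> real^2 \<Rightarrow> real" where
  "dphi n F \<phi> \<psi> = (deriv ^^ n) (\<lambda>x. F x \<psi>) \<phi>"

text \<open>
  For periodic functions, Hoelder continuity with respect to the Euclidean distance of the plane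
  and with respect to the quotient distance of the torus agree, with the same constant.
\<close>

definition BB :: "real \<Rightarrow> nat \<Rightarrow> (real \<Rightarrow> real^2 \<Rightarrow> real) set" where
  "BB \<alpha> N =
     {F. on_circle_torus F \<and>
        (\<forall>n<N. \<forall>\<phi> \<psi>. (\<lambda>x. dphi n F x \<psi>) differentiable (at \<phi>)) \<and>
        (\<forall>\<psi>. continuous_on UNIV (\<lambda>\<phi>. dphi N F \<phi> \<psi>)) \<and>
        (\<forall>n\<le>N. \<exists>C. \<forall>\<phi> \<psi>. \<bar>dphi n F \<phi> \<psi>\<bar> \<le> C) \<and>
        (\<forall>n<N. \<exists>C. \<forall>\<phi> \<psi> \<psi>'. \<bar>dphi n F \<phi> \<psi> - dphi n F \<phi> \<psi>'\<bar> \<le> C * dist \<psi> \<psi>' powr \<alpha>)}"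

definition skew_map ::
  "real^2^2 \<Rightarrow> (real \<Rightarrow> real^2 \<Rightarrow> real) \<Rightarrow> real \<times> (real^2) \<Rightarrow> real \<times> (real^2)" where
  "skew_map A F = (\<lambda>(\<phi>, \<psi>). (\<phi> + F \<phi> \<psi>, A *v \<psi>))"

text \<open>
  The condition \<open>\<phi>\<^sub>M < \<phi>\<^sub>m + 2\<pi>\<close> says that the interval projects to a proper closed arc of the circle.
\<close>

definition hypothesis1 :: "(real \<Rightarrow> real^2 \<Rightarrow> real) \<Rightarrow> real \<Rightarrow> real \<Rightarrow> bool" where
  "hypothesis1 F \<phi>\<^sub>m \<phi>\<^sub>M \<longleftrightarrow>
     \<phi>\<^sub>m < \<phi>\<^sub>M \<and> \<phi>\<^sub>M < \<phi>\<^sub>m + 2 * pi \<and>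
     (\<forall>\<phi>\<in>{\<phi>\<^sub>m..\<phi>\<^sub>M}. \<forall>\<psi>. 1 + dphi 1 F \<phi> \<psi> > 0) \<and>
     (\<forall>\<psi>. F \<phi>\<^sub>m \<psi> > 0 \<and> F \<phi>\<^sub>M \<psi> < 0)"

definition hypothesis2 :: "(real \<Rightarrow> real^2 \<Rightarrow> real) \<Rightarrow> real \<Rightarrow> real \<Rightarrow> bool" where
  "hypothesis2 F \<phi>\<^sub>m \<phi>\<^sub>M \<longleftrightarrow> (\<forall>\<psi>. \<exists>!s. s \<in> interior {\<phi>\<^sub>m..\<phi>\<^sub>M} \<and> F s \<psi> = 0)"

definition zero_S :: "(real \<Rightarrow> real^2 \<Rightarrow> real) \<Rightarrow> real \<Rightarrow> real \<Rightarrow> real^2 \<Rightarrow> real" where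
  "zero_S F \<phi>\<^sub>m \<phi>\<^sub>M \<psi> = (THE s. s \<in> interior {\<phi>\<^sub>m..\<phi>\<^sub>M} \<and> F s \<psi> = 0)"

definition Lambda :: "(real \<Rightarrow> real^2 \<Rightarrow> real) \<Rightarrow> real \<Rightarrow> real \<Rightarrow> (real \<times> (real^2)) set" where
  "Lambda F \<phi>\<^sub>m \<phi>\<^sub>M = {(INF \<psi>. zero_S F \<phi>\<^sub>m \<phi>\<^sub>M \<psi>)..(SUP \<psi>. zero_S F \<phi>\<^sub>m \<phi>\<^sub>M \<psi>)} \<times> UNIV"

definition Gamma_rate :: "(real \<Rightarrow> real^2 \<Rightarrow> real) \<Rightarrow> real \<Rightarrow> real \<Rightarrow> real" where
  "Gamma_rate F \<phi>\<^sub>m \<phi>\<^sub>M = - (SUP (\<phi>, \<psi>)\<in>Lambda F \<phi>\<^sub>m \<phi>\<^sub>M. dphi 1 F \<phi> \<psi>)"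

definition hypothesis3 :: "(real \<Rightarrow> real^2 \<Rightarrow> real) \<Rightarrow> real \<Rightarrow> real \<Rightarrow> bool" where
  "hypothesis3 F \<phi>\<^sub>m \<phi>\<^sub>M \<longleftrightarrow> Gamma_rate F \<phi>\<^sub>m \<phi>\<^sub>M > 0"

definition graph_of :: "(real^2 \<Rightarrow> real) \<Rightarrow> (real \<times> (real^2)) set" where
  "graph_of W = {(W \<psi>, \<psi>) | \<psi>. True}"

definition invariant_graph ::
  "real^2^2 \<Rightarrow> (real \<Rightarrow> real^2 \<Rightarrow> real) \<Rightarrow> real \<Rightarrow> real \<Rightarrow> (real^2 \<Rightarrow> real) \<Rightarrow> bool" where
  "invariant_graph A F \<phi>\<^sub>m \<phi>\<^sub>M W \<longleftrightarrow>
     on_torus W \<and> graph_of W \<subseteq> Lambda F \<phi>\<^sub>m \<phi>\<^sub>M \<and>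
     (\<forall>\<psi>. skew_map A F (W \<psi>, \<psi>) = (W (A *v \<psi>), A *v \<psi>))"

end

theory Submission
  imports Defs
begin

text \<open>
  On the strip \<open>\<Lambda>\<close> every fibre map \<open>\<phi> \<mapsto> \<phi> + F \<phi> \<psi>\<close> is increasing, maps \<open>[S\<^sub>m, S\<^sub>M]\<close> into itself and
  contracts by \<open>q = 1 - \<Gamma>\<close>. An invariant graph satisfies \<open>W \<psi> = f (B \<psi>) (W (B \<psi>))\<close> with
  \<open>B = A\<^sub>0\<^sup>-\<^sup>1\<close>; it is obtained as the increasing limit of the iterates of the constant \<open>S\<^sub>m\<close>.
  Comparing two points along their backward orbits costs a factor \<open>q\<close> per step, while the
  \<open>\<alpha>\<close>-Hoelder error of \<open>F\<close> grows at most like \<open>L\<^sup>\<alpha>\<close> per step, where \<open>L\<close> bounds the norm of \<open>B\<close>.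
  Uniqueness, periodicity and Hoelder continuity all follow from this comparison, the last one as
  soon as \<open>\<alpha>\<close> is so small that \<open>q L\<^sup>\<alpha> < 1\<close>. Then \<open>W\<close> is even globally \<open>\<alpha>\<close>-Hoelder, so
  \<open>\<alpha>\<^sub>- = \<alpha>\<^sub>+ = \<alpha>\<close> works.
\<close>

section \<open>Contracting fibre maps\<close>

text \<open>Unrolling \<open>n\<close> steps leaves a partial geometric series in
  \<open>q * r\<close> and a remainder at most \<open>q ^ n * D\<close>, which vanishes as
  \<open>n\<close> grows. The ratio \<open>r\<close> may exceed 1; only the product
  \<open>q * r\<close> has to be below 1.\<close>

lemma geometric_recursion_bound:
  fixes d :: "nat \<Rightarrow> real"
  assumes rec: "\<And>k. d k \<le> q * d (Suc k) + c * r ^ k"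
    and bd: "\<And>k. d k \<le> D" and q: "0 \<le> q" "q < 1" and r: "0 \<le> r" "q * r < 1" and c: "0 \<le> c"
  shows "d 0 \<le> c / (1 - q * r)"
proof -
  \<comment> \<open>The sequence \<open>c * r ^ k / (1 - q * r)\<close> solves the recursion with
    equality. The claim is made for all \<open>k\<close> at once because the induction step passes
    from \<open>k\<close> to \<open>Suc k\<close>.\<close>
  have *: "d k \<le> c * r ^ k / (1 - q * r) + q ^ n * D" for n k
  proof (induction n arbitrary: k)
    case 0
    have "0 \<le> c * r ^ k / (1 - q * r)" using c r by simp
    then show ?case using bd[of k] by simp
  next
    case (Suc n)
    have "d k \<le> q * (c * r ^ Suc k / (1 - q * r) + q ^ n * D) + c * r ^ k"
      using rec[of k] mult_left_mono[OF Suc.IH[of "Suc k"] q(1)] by linarith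
    also have "\<dots> = c * r ^ k / (1 - q * r) + q ^ Suc n * D"
      using r by (simp add: field_simps)
    finally show ?case .
  qed
  have "(\<lambda>n. c / (1 - q * r) + q ^ n * D) \<longlonglongrightarrow> c / (1 - q * r) + 0 * D"
    by (intro tendsto_intros LIMSEQ_power_zero) (use q in auto)
  then have "d 0 \<le> c / (1 - q * r) + 0 * D"
    by (rule LIMSEQ_le_const) (use *[of 0] in auto)
  then show ?thesis by simp
qed

locale fibre_contraction =
  fixes f :: "'a \<Rightarrow> real \<Rightarrow> real" and q a b :: real
  assumes ab: "a \<le> b" and q: "0 \<le> q" "q < 1"
    and maps: "\<And>\<psi> x. x \<in> {a..b} \<Longrightarrow> f \<psi> x \<in> {a..b}"
    and mono: "\<And>\<psi> x y. x \<in> {a..b} \<Longrightarrow> y \<in> {a..b} \<Longrightarrow> x \<le> y \<Longrightarrow> f \<psi> x \<le> f \<psi> y"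
    and contract: "\<And>\<psi> x y. x \<in> {a..b} \<Longrightarrow> y \<in> {a..b} \<Longrightarrow> \<bar>f \<psi> x - f \<psi> y\<bar> \<le> q * \<bar>x - y\<bar>"
begin

text \<open>With \<open>B\<close> in the role of the inverse base map, this is the fixed point
  equation of the graph transform: values are pulled from the past, which is the direction in which
  the fibres contract.\<close>

definition invariant :: "('a \<Rightarrow> 'a) \<Rightarrow> ('a \<Rightarrow> real) \<Rightarrow> bool" where
  "invariant B W \<longleftrightarrow> (\<forall>\<psi>. W \<psi> \<in> {a..b} \<and> W \<psi> = f (B \<psi>) (W (B \<psi>)))"

lemma invariant_range: "invariant B W \<Longrightarrow> W \<psi> \<in> {a..b}"
  unfolding invariant_def by blast

lemma invariant_step: "invariant B W \<Longrightarrow> W \<psi> = f (B \<psi>) (W (B \<psi>))"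
  unfolding invariant_def by blast

text \<open>Two functions and two base points are compared at once: \<open>c = 0\<close> yields
  uniqueness and periodicity, \<open>V = W\<close> yields Hoelder continuity. The gap after
  \<open>k\<close> backward steps satisfies the recursion of
  \<open>geometric_recursion_bound\<close>.\<close>

lemma invariant_dist_le:
  assumes W: "invariant B W" and V: "invariant B V"
    and e: "\<And>k x. x \<in> {a..b} \<Longrightarrow>
      \<bar>f ((B ^^ Suc k) \<psi>) x - f ((B ^^ Suc k) \<psi>') x\<bar> \<le> c * r ^ k"
    and r: "0 \<le> r" "q * r < 1" and c: "0 \<le> c"
  shows "\<bar>W \<psi> - V \<psi>'\<bar> \<le> c / (1 - q * r)"
proof -
  define d where "d k = \<bar>W ((B ^^ k) \<psi>) - V ((B ^^ k) \<psi>')\<bar>" for k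
  have Wab: "W \<psi> \<in> {a..b}" "V \<psi> \<in> {a..b}" for \<psi>
    using invariant_range W V by blast+
  have "d 0 \<le> c / (1 - q * r)"
  proof (rule geometric_recursion_bound[OF _ _ q r c])
    fix k
    show "d k \<le> b - a"
      using Wab(1)[of "(B ^^ k) \<psi>"] Wab(2)[of "(B ^^ k) \<psi>'"] unfolding d_def by auto
    let ?p = "(B ^^ Suc k) \<psi>" and ?p' = "(B ^^ Suc k) \<psi>'"
    have "W ((B ^^ k) \<psi>) = f ?p (W ?p)" "V ((B ^^ k) \<psi>') = f ?p' (V ?p')"
      using invariant_step[OF W, of "(B ^^ k) \<psi>"] invariant_step[OF V, of "(B ^^ k) \<psi>'"]
      by simp_all
    \<comment> \<open>Triangle inequality through \<open>f ?p (V ?p')\<close>: first the fibre value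
      changes, which contracts, then the base point, which costs the error \<open>e\<close>.\<close>
    moreover have "\<bar>f ?p (W ?p) - f ?p (V ?p')\<bar> \<le> q * \<bar>W ?p - V ?p'\<bar>"
      by (intro contract Wab)
    moreover have "\<bar>f ?p (V ?p') - f ?p' (V ?p')\<bar> \<le> c * r ^ k"
      by (intro e Wab)
    ultimately show "d k \<le> q * d (Suc k) + c * r ^ k"
      unfolding d_def by linarith
  qed
  then show ?thesis by (simp add: d_def)
qed

text \<open>Equal base points give uniqueness; base points differing by a lattice vector give
  periodicity.\<close>

lemma invariant_eqI:
  assumes "invariant B W" and "invariant B V"
    and "\<And>k. f ((B ^^ Suc k) \<psi>) = f ((B ^^ Suc k) \<psi>')"
  shows "W \<psi> = V \<psi>'"
  using invariant_dist_le[OF assms(1,2), of \<psi> \<psi>' 0 0] assms(3) by simp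

lemma invariant_exists: "\<exists>W. invariant B W"
proof -
  define U where "U n = ((\<lambda>V \<psi>. f (B \<psi>) (V (B \<psi>))) ^^ n) (\<lambda>_. a)" for n
  have U0: "U 0 \<psi> = a" and US: "U (Suc n) \<psi> = f (B \<psi>) (U n (B \<psi>))" for n \<psi>
    by (simp_all add: U_def)
  have Uab: "U n \<psi> \<in> {a..b}" for n \<psi>
    by (induction n arbitrary: \<psi>) (use ab maps in \<open>auto simp: U0 US\<close>)
  \<comment> \<open>The start \<open>a\<close> is the lowest admissible value, so the first step
    cannot decrease; monotone fibre maps propagate this order.\<close>
  have "U n \<psi> \<le> U (Suc n) \<psi>" for n \<psi>
  proof (induction n arbitrary: \<psi>)
    case 0
    then show ?case using Uab[of 1 \<psi>] by (simp add: U0)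
  next
    case (Suc n)
    have "f (B \<psi>) (U n (B \<psi>)) \<le> f (B \<psi>) (U (Suc n) (B \<psi>))"
      by (rule mono[OF Uab Uab Suc.IH])
    then show ?case by (simp only: US)
  qed
  then have inc: "incseq (\<lambda>n. U n \<psi>)" for \<psi> by (simp add: incseq_Suc_iff)
  have "\<exists>l. (\<lambda>n. U n \<psi>) \<longlonglongrightarrow> l" for \<psi>
    using incseq_convergent[OF inc[of \<psi>], of b] Uab by (metis atLeastAtMost_iff)
  then obtain W where lim: "\<And>\<psi>. (\<lambda>n. U n \<psi>) \<longlonglongrightarrow> W \<psi>" by metis
  have Wab: "W \<psi> \<in> {a..b}" for \<psi>
    by (rule closed_sequentially[OF closed_atLeastAtMost _ lim]) (use Uab in blast)
  \<comment> \<open>Each fibre map is \<open>q\<close>-Lipschitz, so the pointwise limit passes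
    through it.\<close>
  have "W \<psi> = f (B \<psi>) (W (B \<psi>))" for \<psi>
  proof (rule LIMSEQ_unique)
    show "(\<lambda>n. U (Suc n) \<psi>) \<longlonglongrightarrow> W \<psi>" using lim by (rule LIMSEQ_Suc)
    have "(\<lambda>n. q * \<bar>U n (B \<psi>) - W (B \<psi>)\<bar>) \<longlonglongrightarrow> q * \<bar>W (B \<psi>) - W (B \<psi>)\<bar>"
      by (intro tendsto_intros lim)
    then have "(\<lambda>n. q * \<bar>U n (B \<psi>) - W (B \<psi>)\<bar>) \<longlonglongrightarrow> 0" by simp
    then have "(\<lambda>n. U (Suc n) \<psi> - f (B \<psi>) (W (B \<psi>))) \<longlonglongrightarrow> 0"
      by (rule Lim_null_comparison[rotated])
        (use contract[OF Uab Wab] in \<open>simp add: US\<close>)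
    then show "(\<lambda>n. U (Suc n) \<psi>) \<longlonglongrightarrow> f (B \<psi>) (W (B \<psi>))"
      by (simp add: LIM_zero_iff)
  qed
  with Wab show ?thesis unfolding invariant_def by blast
qed

end

section \<open>The inverse of an automorphism of the torus\<close>

text \<open>The inverse is the adjugate divided by the determinant; for determinant 1 or -1,
  dividing by it is the same as multiplying, so the entries stay integers.\<close>

lemma unimodular_integer_inverse:
  fixes A :: "real^2^2"
  assumes int: "\<And>i j. A $ i $ j \<in> \<int>" and det: "\<bar>det A\<bar> = 1"
  obtains B :: "real^2^2" where "\<And>i j. B $ i $ j \<in> \<int>" "A ** B = mat 1" "B ** A = mat 1"
proof
  define B :: "real^2^2" where
    "B = (\<chi> i j. det A * (if i \<noteq> j then - A $ i $ j else if i = 1 then A $ 2 $ 2 else A $ 1 $ 1))"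
  have "det A = 1 \<or> det A = -1" using det by linarith
  then show "B $ i $ j \<in> \<int>" for i j
    using int by (auto simp: B_def)
  have "det A * det A = 1" using \<open>det A = 1 \<or> det A = -1\<close> by auto
  then show AB: "A ** B = mat 1"
    by (simp add: vec_eq_iff forall_2 matrix_matrix_mult_def sum_2 B_def mat_def det_2
        algebra_simps)
  then show "B ** A = mat 1" using matrix_left_right_inverse by blast
qed

lemma integer_matrix_translation:
  fixes B :: "real^'n^'n" and k :: "int^'n"
  assumes "\<And>i j. B $ i $ j \<in> \<int>"
  obtains k' :: "int^'n" where
    "\<And>\<psi>. B *v (\<psi> + (\<chi> i. c * of_int (k $ i))) = B *v \<psi> + (\<chi> i. c * of_int (k' $ i))"
proof
  \<comment> \<open>The entries of \<open>B\<close> are reals that happen to be integers; the floor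
    reads them off in type \<open>int\<close>.\<close>
  define k' :: "int^'n" where "k' = (\<chi> i. \<Sum>j\<in>UNIV. \<lfloor>B $ i $ j\<rfloor> * k $ j)"
  have floor_B: "of_int \<lfloor>B $ i $ j\<rfloor> = B $ i $ j" for i j using assms by simp
  have "B *v (\<chi> i. c * of_int (k $ i)) = (\<chi> i. c * of_int (k' $ i))"
    by (simp add: vec_eq_iff matrix_vector_mult_def k'_def sum_distrib_left floor_B mult_ac
        del: of_int_floor_cancel)
  then show "B *v (\<psi> + (\<chi> i. c * of_int (k $ i))) = B *v \<psi> + (\<chi> i. c * of_int (k' $ i))" for \<psi>
    by (simp add: matrix_vector_right_distrib)
qed

text \<open>Each step turns a lattice translation into another one, hence the induction over
  arbitrary \<open>k\<close>. With function-valued \<open>g\<close> it says that the orbits of a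
  point and of its translate meet the same fibre maps.\<close>

lemma on_torus_integer_matrix_iterate:
  fixes B :: "real^2^2"
  assumes g: "on_torus g" and B: "\<And>i j. B $ i $ j \<in> \<int>"
  shows "g (((*v) B ^^ n) (\<psi> + (\<chi> i. 2 * pi * of_int (k $ i)))) = g (((*v) B ^^ n) \<psi>)"
proof (induction n arbitrary: \<psi> k)
  case 0
  then show ?case using g by (simp add: on_torus_def)
next
  case (Suc n)
  obtain k' :: "int^2" where "\<And>\<psi>. B *v (\<psi> + (\<chi> i. 2 * pi * of_int (k $ i)))
      = B *v \<psi> + (\<chi> i. 2 * pi * of_int (k' $ i))"
    using integer_matrix_translation[OF B] by metis
  then show ?case using Suc.IH[of "B *v \<psi>" k'] by (simp add: funpow_swap1)
qed

section \<open>Hoelder functions\<close>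

text \<open>For \<open>t \<le> 1\<close> lowering the exponent only increases the power; for larger
  \<open>t\<close> the power is at least 1 and the uniform bound \<open>M\<close> takes
  over.\<close>

lemma holder_smaller_exponent:
  fixes x C M \<alpha> \<beta> t :: real
  assumes "x \<le> C * t powr \<beta>" "x \<le> M" "0 < \<alpha>" "\<alpha> \<le> \<beta>" "0 \<le> t"
  shows "x \<le> (\<bar>C\<bar> + \<bar>M\<bar>) * t powr \<alpha>"
proof (cases "t \<le> 1")
  case True
  have "t powr \<beta> \<le> t powr \<alpha>"
    using True assms by (intro powr_mono') auto
  then have "C * t powr \<beta> \<le> \<bar>C\<bar> * t powr \<alpha>"
    by (intro mult_mono) auto
  moreover have "0 \<le> \<bar>M\<bar> * t powr \<alpha>" by simp
  ultimately show ?thesis using assms(1) unfolding distrib_right by linarith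
next
  case False
  have "1 \<le> t powr \<alpha>" using False assms by (intro ge_one_powr_ge_zero) auto
  then have "\<bar>M\<bar> * 1 \<le> \<bar>M\<bar> * t powr \<alpha>" by (intro mult_left_mono) auto
  moreover have "0 \<le> \<bar>C\<bar> * t powr \<alpha>" by simp
  moreover have "M \<le> \<bar>M\<bar>" by simp
  ultimately show ?thesis using assms(2) unfolding distrib_right by linarith
qed

text \<open>As the exponent tends to 0 from the right, \<open>L powr \<alpha>\<close> tends to 1 and
  the product to \<open>q < 1\<close>.\<close>

lemma exists_small_exponent:
  fixes q L \<beta> :: real
  assumes "q < 1" "0 < L" "0 < \<beta>"
  obtains \<alpha> where "0 < \<alpha>" "\<alpha> \<le> \<beta>" "q * L powr \<alpha> < 1"
proof -
  have "((\<lambda>\<alpha>. q * L powr \<alpha>) \<longlongrightarrow> q * L powr 0) (at_right 0)"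
    by (intro tendsto_intros) (use assms in auto)
  then have "eventually (\<lambda>\<alpha>. q * L powr \<alpha> < 1) (at_right 0)"
    by (rule order_tendstoD) (use assms in auto)
  moreover have "eventually (\<lambda>\<alpha>. \<alpha> \<in> {0<..<\<beta>}) (at_right (0::real))"
    using assms by (intro eventually_at_right_real)
  ultimately have "eventually (\<lambda>\<alpha>. q * L powr \<alpha> < 1 \<and> \<alpha> \<in> {0<..<\<beta>}) (at_right 0)"
    by (rule eventually_conj)
  then obtain \<alpha> where "q * L powr \<alpha> < 1" "\<alpha> \<in> {0<..<\<beta>}"
    using eventually_happens'[OF trivial_limit_at_right_real] by blast
  then show ?thesis by (intro that[of \<alpha>]) auto
qed

lemma directional_seminorm_finite:
  assumes "\<And>\<psi> \<psi>'. \<bar>g \<psi> - g \<psi>'\<bar> \<le> K * dist \<psi> \<psi>' powr \<alpha>" and "norm v = 1"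
  shows "directional_seminorm v \<alpha> g < \<infinity>"
proof -
  have "\<bar>g (\<psi> + x *\<^sub>R v) - g \<psi>\<bar> / \<bar>x\<bar> powr \<alpha> \<le> K" if "x \<noteq> 0" for \<psi> x
    using assms(1)[of "\<psi> + x *\<^sub>R v" \<psi>] assms(2) that by (simp add: dist_norm divide_le_eq)
  then have "directional_seminorm v \<alpha> g \<le> ennreal K"
    unfolding directional_seminorm_def by (intro SUP_least ennreal_leI) auto
  then show ?thesis by (simp add: order_le_less_trans)
qed

lemma holder_continuous_on:
  fixes g :: "'a::metric_space \<Rightarrow> real"
  assumes "\<And>x y. \<bar>g x - g y\<bar> \<le> K * dist x y powr \<alpha>" and "0 < \<alpha>"
  shows "continuous_on S g"
  unfolding continuous_on_def
proof
  fix x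
  \<comment> \<open>The base tends to 0, where continuity of \<open>powr\<close> rests on the
    positive exponent.\<close>
  have "((\<lambda>y. K * dist y x powr \<alpha>) \<longlongrightarrow> K * dist x x powr \<alpha>) (at x within S)"
    using assms(2) by (intro tendsto_intros tendsto_powr') auto
  then have "((\<lambda>y. K * dist y x powr \<alpha>) \<longlongrightarrow> 0) (at x within S)" using assms(2) by simp
  then have "((\<lambda>y. g y - g x) \<longlongrightarrow> 0) (at x within S)"
    by (rule Lim_null_comparison[rotated]) (use assms(1) in simp)
  then show "(g \<longlongrightarrow> g x) (at x within S)" by (rule LIM_zero_cancel)
qed

lemma holder_in_Bstar:
  assumes holder: "\<And>\<psi> \<psi>'. \<bar>g \<psi> - g \<psi>'\<bar> \<le> K * dist \<psi> \<psi>' powr \<alpha>" and "0 < \<alpha>"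
    and bound: "\<And>\<psi>. \<bar>g \<psi>\<bar> \<le> M" and "on_torus g" and "norm vm = 1" "norm vp = 1"
  shows "g \<in> Bstar vm vp \<alpha> \<alpha>"
proof -
  have "(SUP \<psi>. ennreal \<bar>g \<psi>\<bar>) \<le> ennreal M"
    by (intro SUP_least ennreal_leI bound)
  then have "(SUP \<psi>. ennreal \<bar>g \<psi>\<bar>) < \<infinity>" by (simp add: order_le_less_trans)
  then have "Bstar_norm vm vp \<alpha> \<alpha> g < \<infinity>"
    using directional_seminorm_finite[OF holder] assms(5,6)
    by (simp add: Bstar_norm_def ennreal_mult_less_top)
  moreover have "bounded (range g)"
    using bound unfolding bounded_iff by auto
  ultimately show ?thesis
    using holder_continuous_on[OF holder] assms(2,4) by (simp add: Bstar_def)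
qed

section \<open>The fibre maps on the strip\<close>

lemma BB_bounded:
  assumes "F \<in> BB \<alpha> N" "n \<le> N"
  obtains C where "\<And>\<phi> \<psi>. \<bar>dphi n F \<phi> \<psi>\<bar> \<le> C"
proof -
  have "\<exists>C. \<forall>\<phi> \<psi>. \<bar>dphi n F \<phi> \<psi>\<bar> \<le> C" using assms by (simp add: BB_def)
  then show ?thesis using that by blast
qed

lemma BB_holder:
  assumes "F \<in> BB \<alpha> N" "n < N"
  obtains C where
    "\<And>\<phi> \<psi> \<psi>'. \<bar>dphi n F \<phi> \<psi> - dphi n F \<phi> \<psi>'\<bar> \<le> C * dist \<psi> \<psi>' powr \<alpha>"
proof -
  have "\<exists>C. \<forall>\<phi> \<psi> \<psi>'. \<bar>dphi n F \<phi> \<psi> - dphi n F \<phi> \<psi>'\<bar> \<le> C * dist \<psi> \<psi>' powr \<alpha>"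
    using assms by (simp add: BB_def)
  then show ?thesis using that by blast
qed

lemma BB_has_derivative:
  assumes "F \<in> BB \<alpha> N" "0 < N"
  shows "((\<lambda>x. F x \<psi>) has_real_derivative dphi 1 F \<phi> \<psi>) (at \<phi>)"
proof -
  have "(\<lambda>x. dphi 0 F x \<psi>) differentiable (at \<phi>)"
    using assms unfolding BB_def by blast
  then have "(\<lambda>x. F x \<psi>) differentiable (at \<phi>)" by (simp add: dphi_def)
  then show ?thesis
    by (simp add: dphi_def DERIV_deriv_iff_real_differentiable)
qed

text \<open>On the strip the derivative of the fibre map lies between 0 (Hypothesis 1) and
  \<open>q = 1 - \<Gamma>\<close>, with \<open>q < 1\<close> by Hypothesis 3. The strip is preserved
  because \<open>F\<close> is nonnegative on its lower edge and nonpositive on its upper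
  edge.\<close>

lemma fibre_contraction_on_Lambda:
  assumes F: "F \<in> BB \<alpha> N" "1 \<le> N"
    and h1: "hypothesis1 F l u" and h2: "hypothesis2 F l u" and h3: "hypothesis3 F l u"
  obtains q a b where "Lambda F l u = {a..b} \<times> UNIV"
    "fibre_contraction (\<lambda>\<psi> x. x + F x \<psi>) q a b"
proof
  let ?S = "zero_S F l u"
  define a b q where "a = (INF \<psi>. ?S \<psi>)" and "b = (SUP \<psi>. ?S \<psi>)"
    and "q = 1 - Gamma_rate F l u"
  show Lam: "Lambda F l u = {a..b} \<times> UNIV" by (simp add: Lambda_def a_def b_def)
  have S: "?S \<psi> \<in> interior {l..u} \<and> F (?S \<psi>) \<psi> = 0" for \<psi>
    unfolding zero_S_def by (rule theI') (use h2 in \<open>simp add: hypothesis2_def\<close>)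
  then have Slu: "?S \<psi> \<in> {l..u}" and FS: "F (?S \<psi>) \<psi> = 0" for \<psi>
    using interior_subset by blast+
  have aS: "a \<le> ?S \<psi>" and Sb: "?S \<psi> \<le> b" for \<psi>
    unfolding a_def b_def using Slu
    by (auto intro!: cINF_lower cSUP_upper bdd_belowI[of _ l] bdd_aboveI[of _ u])
  have la: "l \<le> a" and bu: "b \<le> u"
    unfolding a_def b_def using Slu by (auto intro!: cINF_greatest cSUP_least)
  have ab: "a \<le> b" using aS[of 0] Sb[of 0] by linarith
  obtain C where C: "\<And>\<phi> \<psi>. \<bar>dphi 1 F \<phi> \<psi>\<bar> \<le> C"
    using BB_bounded[OF F] by blast
  have le: "dphi 1 F \<phi> \<psi> \<le> q - 1" if "\<phi> \<in> {a..b}" for \<phi> \<psi>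
  proof -
    \<comment> \<open>A real supremum dominates its members only over a set bounded above; the bound
      comes from membership in \<open>BB\<close>.\<close>
    have "bdd_above ((\<lambda>(\<phi>, \<psi>). dphi 1 F \<phi> \<psi>) ` Lambda F l u)"
      using C by (intro bdd_aboveI[of _ C]) (auto simp: abs_le_iff)
    then have "dphi 1 F \<phi> \<psi> \<le> (SUP (\<phi>, \<psi>)\<in>Lambda F l u. dphi 1 F \<phi> \<psi>)"
      using that Lam cSUP_upper[of "(\<phi>, \<psi>)" "Lambda F l u" "\<lambda>(\<phi>, \<psi>). dphi 1 F \<phi> \<psi>"] by auto
    then show ?thesis by (simp add: q_def Gamma_rate_def)
  qed
  have gt: "0 < 1 + dphi 1 F \<phi> \<psi>" if "\<phi> \<in> {a..b}" for \<phi> \<psi>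
    using h1 that la bu by (auto simp: hypothesis1_def)
  have q1: "q < 1" using h3 by (simp add: hypothesis3_def q_def)
  have q0: "0 \<le> q" using gt[of a 0] le[of a 0] ab by simp
  note D [derivative_intros] = BB_has_derivative[OF F(1)]
  have mono: "x + F x \<psi> \<le> y + F y \<psi>" if "a \<le> x" "x \<le> y" "y \<le> b" for x y \<psi>
  proof (rule DERIV_nonneg_imp_nondecreasing[of x y "\<lambda>x. x + F x \<psi>"])
    fix t assume t: "x \<le> t" "t \<le> y"
    have "((\<lambda>x. x + F x \<psi>) has_real_derivative 1 + dphi 1 F t \<psi>) (at t)"
      using F by (auto intro!: derivative_eq_intros)
    then show "\<exists>z. ((\<lambda>x. x + F x \<psi>) has_real_derivative z) (at t) \<and> 0 \<le> z"
      using gt[of t \<psi>] t that by (intro exI[of _ "1 + dphi 1 F t \<psi>"]) auto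
  qed (use that in auto)
  \<comment> \<open>Subtracting the linear function of slope \<open>q - 1\<close> encodes the
    derivative bound as monotonicity. This serves both the signs at the edges and the contraction
    estimate.\<close>
  have contr: "F y \<psi> - (q - 1) * y \<le> F x \<psi> - (q - 1) * x" if "a \<le> x" "x \<le> y" "y \<le> b" for x y \<psi>
  proof (rule DERIV_nonpos_imp_nonincreasing[of x y "\<lambda>x. F x \<psi> - (q - 1) * x"])
    fix t assume t: "x \<le> t" "t \<le> y"
    have "((\<lambda>x. F x \<psi> - (q - 1) * x) has_real_derivative dphi 1 F t \<psi> - (q - 1)) (at t)"
      using F by (auto intro!: derivative_eq_intros)
    then show "\<exists>z. ((\<lambda>x. F x \<psi> - (q - 1) * x) has_real_derivative z) (at t) \<and> z \<le> 0"
      using le[of t \<psi>] t that by (intro exI[of _ "dphi 1 F t \<psi> - (q - 1)"]) auto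
  qed (use that in auto)
  \<comment> \<open>The zero \<open>?S \<psi>\<close> lies between \<open>a\<close> and
    \<open>b\<close>, and \<open>F\<close> decreases in the strip.\<close>
  have Fa: "0 \<le> F a \<psi>" and Fb: "F b \<psi> \<le> 0" for \<psi>
  proof -
    have "(q - 1) * (?S \<psi> - a) \<le> 0" "(q - 1) * (b - ?S \<psi>) \<le> 0"
      using q1 aS[of \<psi>] Sb[of \<psi>] by (auto intro: mult_nonpos_nonneg)
    moreover have "F b \<psi> \<le> F (?S \<psi>) \<psi> + (q - 1) * (b - ?S \<psi>)"
      using contr[of "?S \<psi>" b \<psi>] aS[of \<psi>] Sb[of \<psi>] by (simp add: algebra_simps)
    moreover have "F (?S \<psi>) \<psi> - (q - 1) * (?S \<psi> - a) \<le> F a \<psi>"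
      using contr[of a "?S \<psi>" \<psi>] aS[of \<psi>] Sb[of \<psi>] by (simp add: algebra_simps)
    ultimately show "0 \<le> F a \<psi>" "F b \<psi> \<le> 0" using FS[of \<psi>] by linarith+
  qed
  have contr': "\<bar>(x + F x \<psi>) - (y + F y \<psi>)\<bar> \<le> q * \<bar>x - y\<bar>"
    if "a \<le> x" "x \<le> y" "y \<le> b" for x y \<psi>
    using contr[OF that, of \<psi>] mono[OF that, of \<psi>] that by (simp add: algebra_simps)
  show "fibre_contraction (\<lambda>\<psi> x. x + F x \<psi>) q a b"
  proof
    fix \<psi> x y assume x: "x \<in> {a..b}"
    show "x + F x \<psi> \<in> {a..b}"
      using mono[of a x \<psi>] mono[of x b \<psi>] x Fa[of \<psi>] Fb[of \<psi>] by auto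
    assume y: "y \<in> {a..b}"
    show "\<bar>(x + F x \<psi>) - (y + F y \<psi>)\<bar> \<le> q * \<bar>x - y\<bar>"
    proof (cases "x \<le> y")
      case True
      then show ?thesis using contr' x y by simp
    next
      case False
      then show ?thesis using contr'[of y x \<psi>] x y by (simp add: abs_minus_commute)
    qed
    show "x + F x \<psi> \<le> y + F y \<psi>" if "x \<le> y"
      using mono[of x y \<psi>] that x y by simp
  qed (fact ab q0 q1)+
qed

section \<open>Hoelder error of \<open>F\<close> and growth of distances along backward
  orbits\<close>

lemma BB_holder_smaller_exponent:
  assumes "F \<in> BB \<beta> N" "0 < N" "0 < \<alpha>" "\<alpha> \<le> \<beta>"
  obtains C where "0 \<le> C" "\<And>\<phi> \<psi> \<psi>'. \<bar>F \<phi> \<psi> - F \<phi> \<psi>'\<bar> \<le> C * dist \<psi> \<psi>' powr \<alpha>"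
proof -
  have F0: "dphi 0 F = F" by (simp add: dphi_def fun_eq_iff)
  obtain M where M: "\<And>\<phi> \<psi>. \<bar>dphi 0 F \<phi> \<psi>\<bar> \<le> M"
    using BB_bounded[OF assms(1), of 0] by blast
  obtain C where C: "\<And>\<phi> \<psi> \<psi>'. \<bar>dphi 0 F \<phi> \<psi> - dphi 0 F \<phi> \<psi>'\<bar> \<le> C * dist \<psi> \<psi>' powr \<beta>"
    using BB_holder[OF assms(1,2)] by blast
  have "\<bar>F \<phi> \<psi> - F \<phi> \<psi>'\<bar> \<le> 2 * M" for \<phi> \<psi> \<psi>'
    using M[of \<phi> \<psi>] M[of \<phi> \<psi>'] unfolding F0 by linarith
  then have "\<bar>F \<phi> \<psi> - F \<phi> \<psi>'\<bar> \<le> (\<bar>C\<bar> + \<bar>2 * M\<bar>) * dist \<psi> \<psi>' powr \<alpha>" for \<phi> \<psi> \<psi>'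
    by (intro holder_smaller_exponent[OF C[unfolded F0]]) (use assms(3,4) in auto)
  then show ?thesis by (intro that[of "\<bar>C\<bar> + \<bar>2 * M\<bar>"]) auto
qed

lemma iterate_bounded_linear_dist:
  fixes T :: "'a::real_normed_vector \<Rightarrow> 'a"
  assumes "linear T" "\<And>x. norm (T x) \<le> L * norm x" "0 \<le> L"
  shows "dist ((T ^^ n) x) ((T ^^ n) y) \<le> L ^ n * dist x y"
proof (induction n)
  case (Suc n)
  have "dist ((T ^^ Suc n) x) ((T ^^ Suc n) y) \<le> L * dist ((T ^^ n) x) ((T ^^ n) y)"
    using assms(2)[of "(T ^^ n) x - (T ^^ n) y"] linear_diff[OF assms(1)]
    by (simp add: dist_norm)
  also have "\<dots> \<le> L * (L ^ n * dist x y)"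
    using Suc assms(3) by (intro mult_left_mono)
  finally show ?case by (simp add: mult_ac)
qed simp

theorem theorem1:
  fixes A\<^sub>0 :: "real^2^2" and lm lp :: real and vm vp :: "real^2"
    and F :: "real \<Rightarrow> real^2 \<Rightarrow> real" and \<alpha>\<^sub>0 \<phi>\<^sub>m \<phi>\<^sub>M :: real
  assumes "anosov_automorphism A\<^sub>0 lm lp vm vp"
    and "\<alpha>\<^sub>0 \<in> {0<..1}"
    and "F \<in> BB \<alpha>\<^sub>0 6"
    and "hypothesis1 F \<phi>\<^sub>m \<phi>\<^sub>M"
    and "hypothesis2 F \<phi>\<^sub>m \<phi>\<^sub>M"
    and "hypothesis3 F \<phi>\<^sub>m \<phi>\<^sub>M"
  shows "(\<exists>!W. invariant_graph A\<^sub>0 F \<phi>\<^sub>m \<phi>\<^sub>M W) \<and>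
         (\<forall>W. invariant_graph A\<^sub>0 F \<phi>\<^sub>m \<phi>\<^sub>M W \<longrightarrow>
            (\<exists>am\<in>{0<..\<alpha>\<^sub>0}. \<exists>ap\<in>{0<..\<alpha>\<^sub>0}. W \<in> Bstar vm vp am ap))"
proof -
  obtain B :: "real^2^2" where B: "\<And>i j. B $ i $ j \<in> \<int>" "A\<^sub>0 ** B = mat 1" "B ** A\<^sub>0 = mat 1"
    using unimodular_integer_inverse assms(1) unfolding anosov_automorphism_def by metis
  have AB: "A\<^sub>0 *v (B *v \<psi>) = \<psi>" and BA: "B *v (A\<^sub>0 *v \<psi>) = \<psi>" for \<psi>
    using B by (simp_all add: matrix_vector_mul_assoc)
  define f where "f = (\<lambda>\<psi> x. x + F x \<psi>)"
  obtain q a b where Lam: "Lambda F \<phi>\<^sub>m \<phi>\<^sub>M = {a..b} \<times> UNIV"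
    and "fibre_contraction f q a b"
    unfolding f_def by (rule fibre_contraction_on_Lambda[OF assms(3) _ assms(4-6)]) simp
  interpret fibre_contraction f q a b by fact
  have backward: "(\<forall>\<psi>. W (A\<^sub>0 *v \<psi>) = f \<psi> (W \<psi>)) \<longleftrightarrow> (\<forall>\<psi>. W \<psi> = f (B *v \<psi>) (W (B *v \<psi>)))" for W
  proof (intro iffI allI)
    fix \<psi> assume "\<forall>\<psi>. W (A\<^sub>0 *v \<psi>) = f \<psi> (W \<psi>)"
    from this[rule_format, of "B *v \<psi>"]
    show "W \<psi> = f (B *v \<psi>) (W (B *v \<psi>))" unfolding AB .
  next
    fix \<psi> assume "\<forall>\<psi>. W \<psi> = f (B *v \<psi>) (W (B *v \<psi>))"
    from this[rule_format, of "A\<^sub>0 *v \<psi>"]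
    show "W (A\<^sub>0 *v \<psi>) = f \<psi> (W \<psi>)" unfolding BA .
  qed
  have graph_iff: "invariant_graph A\<^sub>0 F \<phi>\<^sub>m \<phi>\<^sub>M W \<longleftrightarrow> on_torus W \<and> invariant ((*v) B) W" for W
  proof -
    have "graph_of W \<subseteq> Lambda F \<phi>\<^sub>m \<phi>\<^sub>M \<longleftrightarrow> (\<forall>\<psi>. W \<psi> \<in> {a..b})"
      by (auto simp: graph_of_def Lam)
    moreover have "skew_map A\<^sub>0 F (W \<psi>, \<psi>) = (W (A\<^sub>0 *v \<psi>), A\<^sub>0 *v \<psi>)
        \<longleftrightarrow> W (A\<^sub>0 *v \<psi>) = f \<psi> (W \<psi>)" for \<psi>
      by (auto simp: skew_map_def f_def)
    ultimately show ?thesis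
      unfolding invariant_graph_def invariant_def all_conj_distrib using backward[of W] by simp
  qed
  have "on_torus (F \<phi>)" for \<phi>
    using assms(3) by (simp add: BB_def on_circle_torus_def)
  then have "on_torus f"
    by (simp add: on_torus_def f_def)
  \<comment> \<open>Periodicity is automatic: translated base points have backward orbits with
    identical fibre maps, so \<open>W\<close> takes the same value at both.\<close>
  have periodic: "on_torus W" if "invariant ((*v) B) W" for W
    unfolding on_torus_def
    by (intro allI invariant_eqI[OF that that]
        on_torus_integer_matrix_iterate[OF \<open>on_torus f\<close> B(1)])
  have ex1: "\<exists>!W. invariant_graph A\<^sub>0 F \<phi>\<^sub>m \<phi>\<^sub>M W"
    unfolding graph_iff using invariant_exists[of "(*v) B"] periodic invariant_eqI by blast

  \<comment> \<open>The summand 1 makes \<open>L\<close> visibly positive, as the choice of the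
    exponent requires.\<close>
  define L where "L = onorm ((*v) B) + 1"
  have "bounded_linear ((*v) B)" by simp
  then have L: "0 < L" "norm (B *v x) \<le> L * norm x" for x
    using onorm[of "(*v) B" x] onorm_pos_le[of "(*v) B"]
    by (auto simp: L_def distrib_right intro: add_increasing2)
  obtain \<alpha> where \<alpha>: "0 < \<alpha>" "\<alpha> \<le> \<alpha>\<^sub>0" "q * L powr \<alpha> < 1"
    using exists_small_exponent[OF q(2) L(1)] assms(2) by auto
  obtain C where C: "0 \<le> C" "\<And>\<phi> \<psi> \<psi>'. \<bar>F \<phi> \<psi> - F \<phi> \<psi>'\<bar> \<le> C * dist \<psi> \<psi>' powr \<alpha>"
    using BB_holder_smaller_exponent[OF assms(3) _ \<alpha>(1,2)] by auto
  have "W \<in> Bstar vm vp \<alpha> \<alpha>" if W: "invariant ((*v) B) W" for W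
  proof (rule holder_in_Bstar)
    fix \<psi> \<psi>'
    \<comment> \<open>The comparison is applied with \<open>r = L powr \<alpha>\<close>. The extra
      factor \<open>L powr \<alpha>\<close> in the constant arises because the fibre map at step
      \<open>k\<close> sits at the iterate \<open>Suc k\<close>.\<close>
    have "\<bar>W \<psi> - W \<psi>'\<bar> \<le> (C * L powr \<alpha> * dist \<psi> \<psi>' powr \<alpha>) / (1 - q * L powr \<alpha>)"
    proof (rule invariant_dist_le[OF W W])
      fix k x
      have "\<bar>F x (((*v) B ^^ Suc k) \<psi>) - F x (((*v) B ^^ Suc k) \<psi>')\<bar>
          \<le> C * dist (((*v) B ^^ Suc k) \<psi>) (((*v) B ^^ Suc k) \<psi>') powr \<alpha>"
        by (rule C)
      also have "\<dots> \<le> C * (L ^ Suc k * dist \<psi> \<psi>') powr \<alpha>"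
        using \<alpha>(1) C(1) L
        by (intro mult_left_mono powr_mono2 iterate_bounded_linear_dist) auto
      also have "\<dots> = C * L powr \<alpha> * dist \<psi> \<psi>' powr \<alpha> * (L powr \<alpha>) ^ k"
        using L(1) by (simp add: powr_mult powr_power powr_powr mult.commute[of \<alpha>]
              flip: powr_realpow)
      finally show "\<bar>f (((*v) B ^^ Suc k) \<psi>) x - f (((*v) B ^^ Suc k) \<psi>') x\<bar>
          \<le> C * L powr \<alpha> * dist \<psi> \<psi>' powr \<alpha> * (L powr \<alpha>) ^ k"
        by (simp add: f_def)
    qed (use \<alpha> C in auto)
    then show "\<bar>W \<psi> - W \<psi>'\<bar> \<le> C * L powr \<alpha> / (1 - q * L powr \<alpha>) * dist \<psi> \<psi>' powr \<alpha>"
      by (simp add: mult_ac)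
  next
    show "\<bar>W \<psi>\<bar> \<le> \<bar>a\<bar> + \<bar>b\<bar>" for \<psi>
      using invariant_range[OF W, of \<psi>] by auto
  qed (use \<alpha> periodic[OF W] assms(1) in \<open>auto simp: anosov_automorphism_def\<close>)
  then have "\<exists>am\<in>{0<..\<alpha>\<^sub>0}. \<exists>ap\<in>{0<..\<alpha>\<^sub>0}. W \<in> Bstar vm vp am ap"
    if "invariant_graph A\<^sub>0 F \<phi>\<^sub>m \<phi>\<^sub>M W" for W
    using that \<alpha> unfolding graph_iff by (metis greaterThanAtMost_iff)
  with ex1 show ?thesis by blast
qed

end
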